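(* For $n\ge1$ and real $x\ge0$ let $F_n(x)=2^{1-n}\#\{j:\ x_j^{(n)}\le x\}$. Define $F:[0,\infty)\to\mathbb{R}$ by $$F([a_0,a_1,a_2,a_3,\ldots])=1-2^{-a_0}+2^{-(a_0+a_1)}-2^{-(a_0+a_1+a_2)}+\cdots,$$ where $[a_0,a_1,\ldots]$ is the regular continued fraction expansion of $x$ (for rational $x=[a_0,\dots,a_m]$ the series terminates with the term involving $a_0+\cdots+a_m$). Then $F_n\to F$ uniformly on $[0,\infty)$. Moreover $F(0)=0$, $F(x)\to1$ as $x\to\infty$, $F$ is monotonically increasing and continuous, and $F$ is singular, i.e. $F'(x)=0$ for Lebesgue-almost every $x$.
   Context: The Calkin--Wilf tree is the infinite rooted binary tree generated from the root $\frac11$ by giving each vertex labelled $\frac ab$ (reduced) a left child $\frac{a}{a+b}$ and a right child $\frac{a+b}{b}$. Its $n$th generation consists of the $2^{n-1}$ vertices at distance $n-1$ from the root, with labels $x_1^{(n)},\dots,x_{2^{n-1}}^{(n)}$. A regular continued fraction $[a_0,a_1,\dots]$ has $a_0\in\mathbb{N}\cup\{0\}$ and $a_i\in\mathbb{N}$ for $i\ge1$. *)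

theory Defs
  imports "HOL-Analysis.Analysis"
begin

definition left_child :: "rat \<Rightarrow> rat" where
  "left_child q = (case quotient_of q of (a, b) \<Rightarrow> Fract a (a + b))"

definition right_child :: "rat \<Rightarrow> rat" where
  "right_child q = (case quotient_of q of (a, b) \<Rightarrow> Fract (a + b) b)"

text \<open>
  A vertex of the Calkin--Wilf tree is the path leading to it from the root:
  \<open>False\<close> means "go left", \<open>True\<close> means "go right". So the vertices of the
  \<open>n\<close>th generation, which are at distance \<open>n - 1\<close> from the root, are the lists
  of length \<open>n - 1\<close>. Generation \<open>0\<close> is empty.
\<close>

definition cw_label :: "bool list \<Rightarrow> rat" where
  "cw_label p = fold (\<lambda>d q. if d then right_child q else left_child q) p (Fract 1 1)"

definition cw_generation :: "nat \<Rightarrow> bool list set" where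
  "cw_generation n = {p. Suc (length p) = n}"

definition cw_dist_gen :: "nat \<Rightarrow> real \<Rightarrow> real" where
  "cw_dist_gen n x =
     2 powi (1 - int n) * real (card {p \<in> cw_generation n. of_rat (cw_label p) \<le> x})"

text \<open>The value for the empty list is irrelevant: expansions below are nonempty.\<close>

fun cf_value :: "nat list \<Rightarrow> real" where
  "cf_value [] = 0"
| "cf_value [a] = real a"
| "cf_value (a # b # as) = real a + 1 / cf_value (b # as)"

definition finite_cf_expansion :: "nat list \<Rightarrow> real \<Rightarrow> bool" where
  "finite_cf_expansion as x \<longleftrightarrow>
     as \<noteq> [] \<and> (\<forall>i. 1 \<le> i \<and> i < length as \<longrightarrow> 1 \<le> as ! i) \<and> cf_value as = x"

definition infinite_cf_expansion :: "(nat \<Rightarrow> nat) \<Rightarrow> real \<Rightarrow> bool" where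
  "infinite_cf_expansion a x \<longleftrightarrow>
     (\<forall>i\<ge>1. 1 \<le> a i) \<and> (\<lambda>n. cf_value (map a [0..<Suc n])) \<longlonglongrightarrow> x"

text \<open>
  The relation \<open>cw_series x y\<close> says that \<open>y\<close> is the value of
  \<open>1 - 2^(-a\<^sub>0) + 2^(-(a\<^sub>0 + a\<^sub>1)) - \<dots>\<close> for some regular continued fraction
  expansion of \<open>x\<close>. No normalisation of the last digit of a finite expansion is imposed, so that a
  positive rational has the two expansions \<open>[a\<^sub>0, \<dots>, a\<^sub>m + 1]\<close> and \<open>[a\<^sub>0, \<dots>, a\<^sub>m, 1]\<close>; both give
  the same value of the series.
\<close>

definition cw_series :: "real \<Rightarrow> real \<Rightarrow> bool" where
  "cw_series x y \<longleftrightarrow>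
     (\<exists>as. finite_cf_expansion as x \<and>
        y = 1 + (\<Sum>k<length as. (-1) ^ Suc k * 2 powi - int (\<Sum>i\<le>k. as ! i))) \<or>
     (\<exists>a. infinite_cf_expansion a x \<and>
        (\<lambda>k. (-1) ^ Suc k * 2 powi - int (\<Sum>i\<le>k. a i)) sums (y - 1))"

definition cw_dist :: "real \<Rightarrow> real" where
  "cw_dist x = (THE y. cw_series x y)"

end

theory Submission
  imports Defs "HOL-Real_Asymp.Real_Asymp"
begin

text \<open>
  The children of \<open>q\<close> are \<open>q / (q + 1) < 1\<close> and \<open>q + 1 > 1\<close>, so the distribution functions satisfy
  \<open>F\<^sub>n\<^sub>+\<^sub>1 = T F\<^sub>n\<close> for the operator \<open>T\<close> (\<open>cw_step\<close>) that puts a scaled copy of its argument on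
  \<open>[0, 1)\<close> and another one on \<open>[1, \<infinity>)\<close>. It is a \<open>1/2\<close>-contraction in the supremum norm, so the
  \<open>F\<^sub>n\<close> converge uniformly to its fixed point, which is continuous because \<open>T\<close> also preserves
  continuous distribution functions. The fixed point equation gives \<open>F (x + 1) = (1 + F x) / 2\<close> and
  \<open>F (1 / x) = 1 - F x\<close>, which evaluate \<open>F\<close> at finite continued fractions; continuity
  extends this to infinite ones.

  For singularity, every Stern--Brocot interval \<open>J\<close> is split by the mediant into two intervals of
  equal \<open>F\<close>-measure, but in two successive splits the lengths cannot both be halved. By
  Cauchy--Schwarz the sum of \<open>sqrt (\<mu> J * |J|)\<close> over the intervals of a generation therefore decays
  geometrically. Collecting the \<open>J\<close> with \<open>\<mu> J \<le> |J|\<close> yields an open set of small \<open>F\<close>-measure whose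
  complement has small Lebesgue measure, and a Vitali covering argument finishes the proof.
\<close>

section \<open>The limit distribution as a fixed point\<close>

text \<open>The arguments \<open>x / (1 - x)\<close> and \<open>x - 1\<close> invert the left and
  right child maps. Left children lie below 1, so from 1 onwards they contribute their full mass
  1/2.\<close>

definition cw_step :: "(real \<Rightarrow> real) \<Rightarrow> real \<Rightarrow> real" where
  "cw_step G x = (if x < 1 then G (x / (1 - x)) / 2 else 1 / 2 + G (x - 1) / 2)"

lemma cw_step_bounds:
  assumes "\<And>x. G x \<in> {0..1}"
  shows "cw_step G x \<in> {0..1}"
  using assms[of "x - 1"] assms[of "x / (1 - x)"] by (auto simp: cw_step_def)

lemma funpow_cw_step_bounds:
  assumes "\<And>x. G x \<in> {0..1}"
  shows "(cw_step ^^ n) G x \<in> {0..1}"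
proof (induction n arbitrary: x)
  case 0
  show ?case using assms by simp
next
  case (Suc n)
  show ?case using cw_step_bounds[OF Suc.IH] by simp
qed

lemma cw_step_contraction:
  assumes "\<And>x. \<bar>G x - H x\<bar> \<le> c"
  shows "\<bar>cw_step G x - cw_step H x\<bar> \<le> c / 2"
  using assms[of "x - 1"] assms[of "x / (1 - x)"] by (auto simp: cw_step_def field_simps)

lemma funpow_cw_step_contraction:
  assumes "\<And>x. \<bar>G x - H x\<bar> \<le> c"
  shows "\<bar>(cw_step ^^ n) G x - (cw_step ^^ n) H x\<bar> \<le> c * (1 / 2) ^ n"
proof (induction n arbitrary: x)
  case 0
  show ?case using assms by simp
next
  case (Suc n)
  show ?case using cw_step_contraction[OF Suc.IH] by simp
qed

lemma abs_diff_unit_interval: "a \<in> {0..1} \<Longrightarrow> b \<in> {0..1} \<Longrightarrow> \<bar>a - b\<bar> \<le> (1::real)"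
  by auto

lemma cw_step_mono:
  assumes "mono G" "\<And>x. G x \<in> {0..1}"
  shows "mono (cw_step G)"
proof (rule monoI)
  fix x y :: real assume "x \<le> y"
  consider "y < 1" | "x < 1" "1 \<le> y" | "1 \<le> x" by linarith
  then show "cw_step G x \<le> cw_step G y"
  proof cases
    case 1
    then have "x / (1 - x) \<le> y / (1 - y)" using \<open>x \<le> y\<close> by (simp add: field_simps)
    then show ?thesis using 1 \<open>x \<le> y\<close> monoD[OF assms(1)] by (simp add: cw_step_def)
  next
    case 2
    then show ?thesis using assms(2)[of "x / (1 - x)"] assms(2)[of "y - 1"]
      by (auto simp: cw_step_def)
  next
    case 3
    then show ?thesis using \<open>x \<le> y\<close> monoD[OF assms(1)] by (simp add: cw_step_def)
  qed
qed

text \<open>The two limits make both branches of \<open>cw_step\<close> agree at the break point \<open>1\<close>.\<close>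

definition cw_profile :: "(real \<Rightarrow> real) \<Rightarrow> bool" where
  "cw_profile G \<longleftrightarrow> mono G \<and> (\<forall>x. G x \<in> {0..1}) \<and> (\<forall>x\<le>0. G x = 0) \<and>
     (\<forall>x. isCont G x) \<and> (G \<longlongrightarrow> 1) at_top"

lemma cw_profile_step:
  assumes "cw_profile G"
  shows "cw_profile (cw_step G)"
proof -
  have G: "mono G" "\<And>x. G x \<in> {0..1}" "\<And>x. x \<le> 0 \<Longrightarrow> G x = 0" "\<And>x. isCont G x"
      "(G \<longlongrightarrow> 1) at_top"
    using assms by (auto simp: cw_profile_def)
  have "isCont (cw_step G) x" for x
  proof -
    consider "x < 1" | "x = 1" | "1 < x" by linarith
    then show ?thesis
    proof cases
      case 1
      have "isCont (\<lambda>x. G (x / (1 - x)) / 2) x"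
        using 1 by (intro continuous_intros isCont_o2[OF _ G(4)]) auto
      moreover have "\<forall>\<^sub>F y in nhds x. G (y / (1 - y)) / 2 = cw_step G y"
        using eventually_nhds_in_open[of "{..<1}" x] 1
        by (auto elim!: eventually_mono simp: cw_step_def)
      ultimately show ?thesis by (simp add: isCont_cong)
    next
      case 3
      have "isCont (\<lambda>x. 1 / 2 + G (x - 1) / 2) x"
        by (intro continuous_intros isCont_o2[OF _ G(4)]) auto
      moreover have "\<forall>\<^sub>F y in nhds x. 1 / 2 + G (y - 1) / 2 = cw_step G y"
        using eventually_nhds_in_open[of "{1<..}" x] 3
        by (auto elim!: eventually_mono simp: cw_step_def)
      ultimately show ?thesis by (simp add: isCont_cong)
    next
      case 2
      have "LIM y at_left (1::real). y / (1 - y) :> at_top"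
        by real_asymp
      from filterlim_compose[OF G(5) this]
      have "((\<lambda>y. G (y / (1 - y)) / 2) \<longlongrightarrow> 1 / 2) (at_left 1)"
        by (intro tendsto_divide tendsto_const) auto
      moreover have "\<forall>\<^sub>F y in at_left 1. G (y / (1 - y)) / 2 = cw_step G y"
        by (simp add: eventually_at_filter cw_step_def)
      ultimately have left: "(cw_step G \<longlongrightarrow> 1 / 2) (at_left 1)"
        by (rule Lim_transform_eventually)
      have "isCont (\<lambda>y. 1 / 2 + G (y - 1) / 2) 1"
        by (intro continuous_intros isCont_o2[OF _ G(4)]) auto
      then have "((\<lambda>y. 1 / 2 + G (y - 1) / 2) \<longlongrightarrow> 1 / 2) (at_right 1)"
        using G(3)[of 0] by (simp add: isCont_def filterlim_at_split)
      moreover have "\<forall>\<^sub>F y in at_right 1. 1 / 2 + G (y - 1) / 2 = cw_step G y"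
        by (simp add: eventually_at_filter cw_step_def)
      ultimately have right: "(cw_step G \<longlongrightarrow> 1 / 2) (at_right 1)"
        by (rule Lim_transform_eventually)
      show ?thesis
        using left right G(3)[of 0] 2 by (simp add: isCont_def filterlim_at_split cw_step_def)
    qed
  qed
  moreover have "(cw_step G \<longlongrightarrow> 1) at_top"
  proof -
    have "LIM x at_top. x - 1 :> (at_top :: real filter)" by real_asymp
    from filterlim_compose[OF G(5) this]
    have "((\<lambda>x. 1 / 2 + G (x - 1) / 2) \<longlongrightarrow> 1 / 2 + 1 / 2) at_top"
      by (intro tendsto_intros) auto
    moreover have "\<forall>\<^sub>F x in at_top. 1 / 2 + G (x - 1) / 2 = cw_step G x"
      using eventually_ge_at_top[of 1] by eventually_elim (simp add: cw_step_def)
    ultimately show ?thesis by (auto intro: Lim_transform_eventually)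
  qed
  moreover have "cw_step G x = 0" if "x \<le> 0" for x
    using that G(3)[of "x / (1 - x)"] by (simp add: cw_step_def divide_le_0_iff)
  ultimately show ?thesis
    using cw_step_mono[OF G(1,2)] cw_step_bounds[of G, OF G(2)] unfolding cw_profile_def by blast
qed

text \<open>The functions of the generations are step functions, so continuity of the limit needs
  another starting point. This one is continuous, and the contraction leads to the same
  limit.\<close>

definition cw_seed :: "real \<Rightarrow> real" where
  "cw_seed x = max 0 x / (1 + max 0 x)"

lemma cw_profile_seed: "cw_profile cw_seed"
proof -
  have "mono cw_seed"
  proof (rule monoI)
    fix x y :: real assume "x \<le> y"
    then have "max 0 x \<le> max 0 y" by simp
    moreover have "u / (1 + u) \<le> v / (1 + v)" if "0 \<le> u" "u \<le> v" for u v :: real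
      using that by (simp add: field_simps)
    ultimately show "cw_seed x \<le> cw_seed y"
      unfolding cw_seed_def by simp
  qed
  moreover have "isCont cw_seed x" for x
    unfolding cw_seed_def by (intro continuous_intros) auto
  moreover have "(cw_seed \<longlongrightarrow> 1) at_top"
  proof -
    have "((\<lambda>x::real. x / (1 + x)) \<longlongrightarrow> 1) at_top" by real_asymp
    moreover have "\<forall>\<^sub>F x in at_top. x / (1 + x) = cw_seed x"
      using eventually_ge_at_top[of 0] by eventually_elim (simp add: cw_seed_def)
    ultimately show ?thesis by (rule Lim_transform_eventually)
  qed
  ultimately show ?thesis
    by (auto simp: cw_profile_def cw_seed_def)
qed

lemma cw_profile_iterate: "cw_profile ((cw_step ^^ n) cw_seed)"
  by (induction n) (auto simp: cw_profile_seed cw_profile_step)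

definition cw_lim :: "real \<Rightarrow> real" where
  "cw_lim x = lim (\<lambda>n. (cw_step ^^ n) cw_seed x)"

lemma cw_seed_bounds: "cw_seed x \<in> {0..1}"
  using cw_profile_seed by (simp add: cw_profile_def)

lemma uniform_limit_iterate_seed:
  "uniform_limit UNIV (\<lambda>n. (cw_step ^^ n) cw_seed) cw_lim sequentially"
proof -
  \<comment> \<open>Both functions are \<open>m\<close>-fold iterates, started at the seed and at
    its \<open>(n - m)\<close>-fold iterate; these starts differ by at most 1.\<close>
  have *: "\<bar>(cw_step ^^ m) cw_seed x - (cw_step ^^ n) cw_seed x\<bar> \<le> (1 / 2) ^ m" if "m < n" for m n x
  proof -
    have "\<bar>(cw_step ^^ m) cw_seed x - (cw_step ^^ m) ((cw_step ^^ (n - m)) cw_seed) x\<bar>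
        \<le> 1 * (1 / 2) ^ m"
      by (intro funpow_cw_step_contraction abs_diff_unit_interval funpow_cw_step_bounds cw_seed_bounds)
    also have "(cw_step ^^ m) ((cw_step ^^ (n - m)) cw_seed) = (cw_step ^^ n) cw_seed"
      using that by (simp flip: funpow_add comp_apply[of "cw_step ^^ m" "cw_step ^^ (n - m)"])
    finally show ?thesis by simp
  qed
  have "uniformly_Cauchy_on UNIV (\<lambda>n. (cw_step ^^ n) cw_seed)"
  proof (rule uniformly_Cauchy_onI')
    fix e :: real assume "e > 0"
    then obtain M where M: "(1 / 2 :: real) ^ M < e"
      using real_arch_pow_inv[of e "1 / 2"] by auto
    show "\<exists>M. \<forall>x\<in>UNIV. \<forall>m\<ge>M. \<forall>n>m.
        dist ((cw_step ^^ m) cw_seed x) ((cw_step ^^ n) cw_seed x) < e"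
    proof (intro exI ballI allI impI)
      fix x :: real and m n assume "M \<le> m" "m < n"
      then have "(1 / 2 :: real) ^ m \<le> (1 / 2) ^ M" by (intro power_decreasing) auto
      with *[OF \<open>m < n\<close>, of x] M
      show "dist ((cw_step ^^ m) cw_seed x) ((cw_step ^^ n) cw_seed x) < e"
        unfolding dist_real_def by linarith
    qed
  qed
  from Cauchy_uniformly_convergent[OF this] show ?thesis
    by (simp add: uniformly_convergent_uniform_limit_iff cw_lim_def[abs_def])
qed

lemma iterate_seed_tendsto: "(\<lambda>n. (cw_step ^^ n) cw_seed x) \<longlonglongrightarrow> cw_lim x"
  using tendsto_uniform_limitI[OF uniform_limit_iterate_seed] by simp

lemma cw_lim_bounds: "cw_lim x \<in> {0..1}"
  by (rule closed_sequentially[OF _ funpow_cw_step_bounds iterate_seed_tendsto])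
    (auto intro!: cw_seed_bounds simp del: atLeastAtMost_iff)

lemma cw_lim_fixed: "cw_step cw_lim = cw_lim"
proof
  fix x
  have "(\<lambda>n. cw_step ((cw_step ^^ n) cw_seed) x) \<longlonglongrightarrow> cw_step cw_lim x"
    unfolding cw_step_def[of _ x] by (auto intro!: tendsto_intros iterate_seed_tendsto)
  moreover have "(\<lambda>n. (cw_step ^^ Suc n) cw_seed x) \<longlonglongrightarrow> cw_lim x"
    using iterate_seed_tendsto by (rule LIMSEQ_Suc)
  ultimately show "cw_step cw_lim x = cw_lim x"
    by (simp add: LIMSEQ_unique)
qed

lemma funpow_cw_step_lim: "(cw_step ^^ n) cw_lim = cw_lim"
  by (induction n) (auto simp: cw_lim_fixed)

text \<open>Stated for arbitrary starts with values in the unit interval, so that it serves both the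
  discontinuous functions of the generations and the uniqueness of the fixed point.\<close>

lemma iterate_close_to_lim:
  assumes "\<And>x. G x \<in> {0..1}"
  shows "\<bar>(cw_step ^^ n) G x - cw_lim x\<bar> \<le> (1 / 2) ^ n"
proof -
  have "\<bar>(cw_step ^^ n) G x - (cw_step ^^ n) cw_lim x\<bar> \<le> 1 * (1 / 2) ^ n"
    by (intro funpow_cw_step_contraction abs_diff_unit_interval assms cw_lim_bounds)
  then show ?thesis by (simp add: funpow_cw_step_lim)
qed

lemma cw_lim_unique:
  assumes "\<And>x. G x \<in> {0..1}" and "cw_step G = G"
  shows "G = cw_lim"
proof
  fix x
  have "(cw_step ^^ n) G = G" for n
    by (induction n) (auto simp: assms(2))
  then have "\<bar>G x - cw_lim x\<bar> \<le> (1 / 2) ^ n" for n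
    using iterate_close_to_lim[of G n x, OF assms(1)] by simp
  moreover have "(\<lambda>n. (1 / 2 :: real) ^ n) \<longlonglongrightarrow> 0" by (intro LIMSEQ_power_zero) simp
  ultimately have "\<bar>G x - cw_lim x\<bar> \<le> 0" using LIMSEQ_le_const by blast
  then show "G x = cw_lim x" by simp
qed

section \<open>Regularity and functional equations of the limit\<close>

lemma cw_lim_mono: "mono cw_lim"
proof (rule monoI)
  fix x y :: real assume "x \<le> y"
  have "(cw_step ^^ n) cw_seed x \<le> (cw_step ^^ n) cw_seed y" for n
    using cw_profile_iterate[of n] \<open>x \<le> y\<close> by (auto simp: cw_profile_def mono_def)
  then show "cw_lim x \<le> cw_lim y"
    using LIMSEQ_le[OF iterate_seed_tendsto iterate_seed_tendsto] by blast
qed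

lemma cw_lim_continuous: "continuous_on UNIV cw_lim"
proof (rule uniform_limit_theorem[OF _ uniform_limit_iterate_seed])
  show "\<forall>\<^sub>F n in sequentially. continuous_on UNIV ((cw_step ^^ n) cw_seed)"
    using cw_profile_iterate by (auto simp: cw_profile_def continuous_at_imp_continuous_on)
qed simp

lemma cw_lim_nonpos: "x \<le> 0 \<Longrightarrow> cw_lim x = 0"
  using LIMSEQ_unique[OF iterate_seed_tendsto, of x 0] cw_profile_iterate
  by (auto simp: cw_profile_def)

lemma cw_lim_add_one: "x \<ge> 0 \<Longrightarrow> cw_lim (x + 1) = 1 / 2 + cw_lim x / 2"
  by (subst cw_lim_fixed[symmetric]) (simp add: cw_step_def)

lemma cw_lim_left: "x \<ge> 0 \<Longrightarrow> cw_lim (x / (x + 1)) = cw_lim x / 2"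
proof -
  assume "x \<ge> 0"
  then have "x / (x + 1) / (1 - x / (x + 1)) = x" "x / (x + 1) < 1" by (auto simp: field_simps)
  then show ?thesis by (subst cw_lim_fixed[symmetric]) (simp add: cw_step_def)
qed

lemma cw_lim_add_nat: "x \<ge> 0 \<Longrightarrow> cw_lim (real n + x) = 1 - (1 / 2) ^ n * (1 - cw_lim x)"
proof (induction n)
  case (Suc n)
  have "cw_lim (real (Suc n) + x) = 1 / 2 + cw_lim (real n + x) / 2"
    using cw_lim_add_one[of "real n + x"] Suc.prems by (simp add: add_ac)
  also have "\<dots> = 1 - (1 / 2) ^ Suc n * (1 - cw_lim x)"
    unfolding Suc.IH[OF Suc.prems] by (simp add: add_divide_distrib diff_divide_distrib algebra_simps)
  finally show ?case .
qed simp

text \<open>Substituting \<open>1 / x\<close> for \<open>x\<close> exchanges the two branches of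
  \<open>cw_step\<close>, as reflecting the tree exchanges left and right children. The reflected
  function is therefore again a fixed point, and uniqueness applies.\<close>

lemma cw_lim_inverse:
  assumes "x > 0"
  shows "cw_lim (1 / x) = 1 - cw_lim x"
proof -
  \<comment> \<open>The value 0 is set by hand: with \<open>1 / 0 = 0\<close> the formula would give
    1 at 0, and the equation at 1 uses \<open>G 0 = 0\<close>.\<close>
  define G where "G x = (if x \<le> 0 then 0 else 1 - cw_lim (1 / x))" for x
  have "G x \<in> {0..1}" for x
    using cw_lim_bounds[of "1 / x"] by (auto simp: G_def)
  moreover have "cw_step G x = G x" for x
  proof -
    consider "x \<le> 0" | "0 < x" "x < 1" | "x = 1" | "1 < x" by linarith
    then show ?thesis
    proof cases
      case 1
      then show ?thesis by (simp add: cw_step_def G_def divide_le_0_iff)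
    next
      case 2
      then have "cw_lim (1 / x) = 1 / 2 + cw_lim (1 / x - 1) / 2"
        using cw_lim_add_one[of "1 / x - 1"] by simp
      moreover have "1 / (x / (1 - x)) = 1 / x - 1" "x / (1 - x) > 0"
        using 2 by (auto simp: field_simps)
      ultimately show ?thesis using 2 by (simp add: cw_step_def G_def field_simps)
    next
      case 3
      have "cw_lim 1 = 1 / 2" using cw_lim_add_one[of 0] by (simp add: cw_lim_nonpos)
      then show ?thesis using 3 by (simp add: cw_step_def G_def)
    next
      case 4
      have "1 / (x - 1) / (1 / (x - 1) + 1) = 1 / x" using 4 by (simp add: field_simps)
      then have "cw_lim (1 / x) = cw_lim (1 / (x - 1)) / 2"
        using cw_lim_left[of "1 / (x - 1)"] 4 by simp
      then show ?thesis using 4 by (simp add: cw_step_def G_def field_simps)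
    qed
  qed
  ultimately have "G = cw_lim" by (intro cw_lim_unique) auto
  then have "G x = cw_lim x" by simp
  then show ?thesis using assms by (simp add: G_def)
qed

lemma cw_lim_at_top: "(cw_lim \<longlongrightarrow> 1) at_top"
proof (rule order_tendstoI)
  fix a :: real assume "a < 1"
  then obtain n where n: "(1 / 2 :: real) ^ n < 1 - a"
    using real_arch_pow_inv[of "1 - a" "1 / 2"] by auto
  have "a < cw_lim (real n)" using cw_lim_add_nat[of 0 n] n by (simp add: cw_lim_nonpos)
  then have "a < cw_lim x" if "real n \<le> x" for x
    using monoD[OF cw_lim_mono that] by linarith
  then show "\<forall>\<^sub>F x in at_top. a < cw_lim x"
    using eventually_ge_at_top[of "real n"] by (rule eventually_mono[rotated])
next
  fix a :: real assume "1 < a"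
  have "cw_lim x < a" for x
    using cw_lim_bounds[of x] \<open>1 < a\<close> by simp
  then show "\<forall>\<^sub>F x in at_top. cw_lim x < a" by simp
qed

section \<open>Generations of the tree and continued fractions\<close>

lemma left_child_eq: "q > 0 \<Longrightarrow> left_child q = q / (q + 1)"
proof -
  assume "q > 0"
  obtain a b where ab: "quotient_of q = (a, b)" by fastforce
  then have q: "q = of_int a / of_int b" and "b > 0"
    using quotient_of_div quotient_of_denom_pos by blast+
  then have "a > 0" using \<open>q > 0\<close> by (simp add: zero_less_divide_iff)
  then show ?thesis using ab \<open>b > 0\<close>
    by (simp add: left_child_def Fract_of_int_quotient q field_simps)
qed

lemma right_child_eq: "right_child q = q + 1"
proof -
  obtain a b where ab: "quotient_of q = (a, b)" by fastforce
  then have q: "q = of_int a / of_int b" and "b > 0"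
    using quotient_of_div quotient_of_denom_pos by blast+
  then show ?thesis using ab
    by (simp add: right_child_def Fract_of_int_quotient q field_simps)
qed

lemma cw_label_Nil: "cw_label [] = 1"
  by (simp add: cw_label_def One_rat_def)

lemma cw_label_snoc:
  "cw_label (p @ [d]) = (if d then right_child (cw_label p) else left_child (cw_label p))"
  by (simp add: cw_label_def)

lemma cw_label_pos: "cw_label p > 0"
proof (induction p rule: rev_induct)
  case Nil
  show ?case by (simp add: cw_label_Nil)
next
  case (snoc d p)
  then show ?case by (simp add: cw_label_snoc left_child_eq right_child_eq add_pos_pos)
qed

lemma cw_generation_Suc: "cw_generation (Suc n) = {p. length p = n}"
  by (simp add: cw_generation_def)

lemma finite_cw_generation: "finite (cw_generation (Suc n))"
  using finite_lists_length_eq[of "UNIV :: bool set" n] by (simp add: cw_generation_Suc)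

lemma card_cw_generation: "card (cw_generation (Suc n)) = 2 ^ n"
  using card_lists_length_eq[of "UNIV :: bool set" n] by (simp add: cw_generation_Suc card_UNIV_bool)

lemma cw_dist_gen_Suc:
  "cw_dist_gen (Suc n) x =
     (1 / 2) ^ n * real (card {p \<in> cw_generation (Suc n). of_rat (cw_label p) \<le> x})"
  by (simp add: cw_dist_gen_def power_int_minus power_divide inverse_eq_divide)

lemma cw_dist_gen_bounds: "cw_dist_gen (Suc n) x \<in> {0..1}"
proof -
  have "card {p \<in> cw_generation (Suc n). of_rat (cw_label p) \<le> x} \<le> 2 ^ n"
    using card_mono[OF finite_cw_generation, of "{p \<in> cw_generation (Suc n). of_rat (cw_label p) \<le> x}" n]
    by (auto simp: card_cw_generation)
  then have "real (card {p \<in> cw_generation (Suc n). of_rat (cw_label p) \<le> x}) \<le> 2 ^ n"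
    by (metis of_nat_le_iff of_nat_numeral of_nat_power)
  then show ?thesis
    by (auto simp: cw_dist_gen_Suc power_divide field_simps)
qed

text \<open>Vertices are sorted by their last direction, which \<open>cw_label\<close> applies last.
  The recursion starts at generation 1: generation 0 is empty, and from there the equation would
  fail at every \<open>x >= 1\<close>.\<close>

lemma cw_dist_gen_step: "cw_dist_gen (Suc (Suc n)) = cw_step (cw_dist_gen (Suc n))"
proof
  fix x :: real
  define A where "A m x = {p \<in> cw_generation (Suc m). of_rat (cw_label p) \<le> x}" for m and x :: real
  have fin: "finite (A m x)" for m x
    using finite_cw_generation by (simp add: A_def)
  have lab: "(0::real) < of_rat (cw_label p)" for p
    using cw_label_pos by simp
  have child: "of_rat (cw_label (p @ [d])) =
      (if d then of_rat (cw_label p) + 1 else of_rat (cw_label p) / (of_rat (cw_label p) + 1 :: real))"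
    for p d
    using cw_label_pos[of p]
    by (simp add: cw_label_snoc left_child_eq right_child_eq of_rat_add of_rat_divide)
  define B where "B d = {p \<in> cw_generation (Suc n). of_rat (cw_label (p @ [d])) \<le> x}" for d
  have "A (Suc n) x = (\<lambda>p. p @ [False]) ` B False \<union> (\<lambda>p. p @ [True]) ` B True"
  proof (intro equalityI subsetI)
    fix p assume p: "p \<in> A (Suc n) x"
    then obtain q d where "p = q @ [d]"
      by (cases p rule: rev_cases) (auto simp: A_def cw_generation_def)
    with p show "p \<in> (\<lambda>p. p @ [False]) ` B False \<union> (\<lambda>p. p @ [True]) ` B True"
      by (cases d) (auto simp: A_def B_def cw_generation_def)
  qed (auto simp: A_def B_def cw_generation_def)
  moreover have "finite (B d)" for d using finite_cw_generation by (simp add: B_def)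
  ultimately have "card (A (Suc n) x) =
      card ((\<lambda>p. p @ [False]) ` B False) + card ((\<lambda>p. p @ [True]) ` B True)"
    by (simp only:) (rule card_Un_disjoint; auto)
  then have card: "card (A (Suc n) x) = card (B False) + card (B True)"
    by (simp add: card_image inj_on_def)
  show "cw_dist_gen (Suc (Suc n)) x = cw_step (cw_dist_gen (Suc n)) x"
  proof (cases "x < 1")
    case True
    have "of_rat (cw_label (p @ [True])) > x" for p
      using True lab[of p] unfolding child if_True by linarith
    then have "B True = {}" by (auto simp: B_def not_le)
    moreover have "B False = A n (x / (1 - x))"
    proof -
      have "y / (y + 1) \<le> x \<longleftrightarrow> y \<le> x / (1 - x)" if "y > 0" for y
        using True that by (simp add: field_simps)
      then show ?thesis using lab by (simp add: A_def B_def child)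
    qed
    ultimately show ?thesis
      using card True by (simp add: cw_dist_gen_Suc cw_step_def A_def)
  next
    case False
    have "of_rat (cw_label (p @ [False])) \<le> x" for p
    proof -
      have "y / (y + 1) \<le> 1" if "y > 0" for y :: real using that by simp
      from this[OF lab] have "of_rat (cw_label (p @ [False])) \<le> (1 :: real)"
        unfolding child by (simp only: if_False)
      then show ?thesis using False by linarith
    qed
    then have "B False = cw_generation (Suc n)" by (auto simp: B_def)
    moreover have "B True = A n (x - 1)"
      using False by (auto simp: A_def B_def child)
    ultimately have "card (A (Suc n) x) = 2 ^ n + card (A n (x - 1))"
      using card card_cw_generation by simp
    then show ?thesis
      using False by (simp add: cw_dist_gen_Suc cw_step_def A_def power_divide field_simps)
  qed
qed

lemma cw_dist_gen_funpow: "cw_dist_gen (Suc n) = (cw_step ^^ n) (cw_dist_gen 1)"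
  by (induction n) (auto simp: cw_dist_gen_step)

lemma cw_dist_gen_close: "\<bar>cw_dist_gen (Suc n) x - cw_lim x\<bar> \<le> (1 / 2) ^ n"
  unfolding cw_dist_gen_funpow using cw_dist_gen_bounds[of 0]
  by (intro iterate_close_to_lim) simp

lemma uniform_limit_cw_dist_gen: "uniform_limit UNIV cw_dist_gen cw_lim sequentially"
proof (rule uniform_limitI)
  fix e :: real assume "e > 0"
  then obtain M where M: "(1 / 2 :: real) ^ M < e"
    using real_arch_pow_inv[of e "1 / 2"] by auto
  show "\<forall>\<^sub>F n in sequentially. \<forall>x\<in>UNIV. dist (cw_dist_gen n x) (cw_lim x) < e"
    using eventually_ge_at_top[of "Suc M"]
  proof eventually_elim
    case (elim n)
    then obtain m where m: "n = Suc m" "M \<le> m" by (cases n) auto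
    then have "(1 / 2 :: real) ^ m \<le> (1 / 2) ^ M" by (intro power_decreasing) auto
    then have "\<bar>cw_dist_gen n x - cw_lim x\<bar> < e" for x
      using cw_dist_gen_close[of m x] M unfolding m(1) by linarith
    then show ?case by (simp add: dist_real_def)
  qed
qed

section \<open>Evaluation of the series on continued fractions\<close>

lemma powi_minus_int: "(2::real) powi - int n = (1 / 2) ^ n"
  by (simp add: power_int_minus power_divide inverse_eq_divide)

text \<open>Horner form of the alternating series. The value 1 of the empty list plays the role of
  \<open>F\<close> at infinity, the tail that follows the last digit.\<close>

definition series_value :: "nat list \<Rightarrow> real" where
  "series_value as = foldr (\<lambda>a v. 1 - (1 / 2) ^ a * v) as 1"

lemma series_value_eq:
  "1 + (\<Sum>k<length as. (-1) ^ Suc k * 2 powi - int (\<Sum>i\<le>k. as ! i)) = series_value as"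
proof (induction as)
  case (Cons a as)
  have "1 + (\<Sum>k<length (a # as). (-1) ^ Suc k * 2 powi - int (\<Sum>i\<le>k. (a # as) ! i)) =
      1 + (- ((1 / 2) ^ a) - (1 / 2 :: real) ^ a *
        (\<Sum>k<length as. (-1) ^ Suc k * 2 powi - int (\<Sum>i\<le>k. as ! i)))"
    unfolding powi_minus_int sum_distrib_left list.size(4) add_Suc_right add_0_right
      sum.lessThan_Suc_shift sum.atMost_Suc_shift
    by (simp add: power_add mult_ac sum_negf)
  also have "\<dots> = 1 - (1 / 2) ^ a * series_value as"
    unfolding Cons.IH[symmetric] by (simp only: algebra_simps mult_1_right)
  finally show ?case
    by (simp add: series_value_def)
qed (simp add: series_value_def)

lemma cf_value_pos:
  assumes "as \<noteq> []" "\<forall>a\<in>set as. 1 \<le> a"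
  shows "cf_value as \<ge> 1"
  using assms
proof (induction as rule: cf_value.induct)
  case (3 a b as)
  then have "1 / cf_value (b # as) > 0" "real a \<ge> 1" by auto
  then have "1 \<le> real a + 1 / cf_value (b # as)" by linarith
  then show ?case by simp
qed auto

text \<open>Translation and inversion combine to
  \<open>F (a + 1 / c) = 1 - (1 / 2) ^ a * F c\<close>, the recursion of
  \<open>series_value\<close>. The leading digit may be 0, so positivity is asked of the tail
  only.\<close>

lemma cw_lim_cf_value:
  assumes "as \<noteq> []" "\<forall>a\<in>set (tl as). 1 \<le> a"
  shows "cw_lim (cf_value as) = series_value as"
  using assms
proof (induction as rule: cf_value.induct)
  case (2 a)
  show ?case using cw_lim_add_nat[of 0 a] by (simp add: series_value_def cw_lim_nonpos)
next
  case (3 a b as)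
  define c where "c = cf_value (b # as)"
  have "c \<ge> 1" unfolding c_def using 3(3) by (intro cf_value_pos) auto
  then have "cw_lim (real a + 1 / c) = 1 - (1 / 2) ^ a * cw_lim c"
    using cw_lim_add_nat[of "1 / c" a] cw_lim_inverse[of c] by simp
  also have "cw_lim c = series_value (b # as)" unfolding c_def using 3 by auto
  finally show ?case by (simp add: series_value_def c_def)
qed auto

lemma tl_map_upt_ge_1:
  assumes "\<forall>i\<ge>1. 1 \<le> a i"
  shows "\<forall>b\<in>set (tl (map a [0..<n])). (1::nat) \<le> b"
  using assms by (cases n) (auto simp: upt_conv_Cons map_tl[symmetric] simp del: upt_Suc)

text \<open>The partial sums, up to the constant 1, are the values of \<open>cw_lim\<close> at the
  convergents, so continuity at \<open>x\<close> gives the sum.\<close>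

lemma infinite_cf_series_sums:
  assumes "infinite_cf_expansion a x"
  shows "(\<lambda>k. (-1) ^ Suc k * 2 powi - int (\<Sum>i\<le>k. a i)) sums (cw_lim x - 1)"
proof -
  define g where "g k = ((-1) ^ Suc k * 2 powi - int (\<Sum>i\<le>k. a i) :: real)" for k
  have partial_sum: "sum g {..<Suc n} = series_value (map a [0..<Suc n]) - 1" for n
  proof -
    define as where "as = map a [0..<Suc n]"
    have "g k = (-1) ^ Suc k * 2 powi - int (\<Sum>i\<le>k. as ! i)" if "k < length as" for k
    proof -
      have "(\<Sum>i\<le>k. a i) = (\<Sum>i\<le>k. as ! i)"
        using that by (intro sum.cong) (auto simp: as_def simp del: upt_Suc)
      then show ?thesis unfolding g_def by (simp only:)
    qed
    then have "sum g {..<length as} =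
        (\<Sum>k<length as. (-1) ^ Suc k * 2 powi - int (\<Sum>i\<le>k. as ! i))"
      by (intro sum.cong) auto
    then have "1 + sum g {..<length as} = series_value as"
      unfolding series_value_eq[symmetric] by (simp only:)
    moreover have "length as = Suc n" by (simp add: as_def)
    ultimately show ?thesis by (simp add: as_def del: upt_Suc)
  qed
  have a: "\<forall>i\<ge>1. 1 \<le> a i" and lim: "(\<lambda>n. cf_value (map a [0..<Suc n])) \<longlonglongrightarrow> x"
    using assms unfolding infinite_cf_expansion_def by (rule conjunct1, rule conjunct2)
  have "isCont cw_lim x" using cw_lim_continuous by (simp add: continuous_on_eq_continuous_at)
  then have "(\<lambda>n. cw_lim (cf_value (map a [0..<Suc n]))) \<longlonglongrightarrow> cw_lim x"
    using lim by (rule isCont_tendsto_compose)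
  also have "(\<lambda>n. cw_lim (cf_value (map a [0..<Suc n]))) = (\<lambda>n. series_value (map a [0..<Suc n]))"
    using tl_map_upt_ge_1[OF a] by (intro ext cw_lim_cf_value) (simp_all del: upt_Suc)
  finally have "(\<lambda>n. sum g {..<Suc n}) \<longlonglongrightarrow> cw_lim x - 1"
    unfolding partial_sum by (intro tendsto_intros)
  then have "g sums (cw_lim x - 1)"
    unfolding sums_def by (rule LIMSEQ_imp_Suc)
  then show ?thesis unfolding g_def .
qed

lemma finite_cf_series_value:
  assumes "finite_cf_expansion as x"
  shows "1 + (\<Sum>k<length as. (-1) ^ Suc k * 2 powi - int (\<Sum>i\<le>k. as ! i)) = cw_lim x"
proof -
  have as: "as \<noteq> []" "\<forall>i. 1 \<le> i \<and> i < length as \<longrightarrow> 1 \<le> as ! i" "cf_value as = x"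
    using assms by (auto simp: finite_cf_expansion_def)
  have "\<forall>a\<in>set (tl as). 1 \<le> a"
  proof
    fix a assume "a \<in> set (tl as)"
    then obtain i where "i < length as - 1" "a = tl as ! i" by (auto simp: in_set_conv_nth)
    then show "1 \<le> a" using as(2) by (simp add: nth_tl)
  qed
  then show ?thesis using cw_lim_cf_value as unfolding series_value_eq by metis
qed

lemma cw_series_finiteI: "finite_cf_expansion as x \<Longrightarrow> cw_series x (cw_lim x)"
  unfolding cw_series_def using finite_cf_series_value[of as x, symmetric] by blast

lemma cw_series_infiniteI: "infinite_cf_expansion a x \<Longrightarrow> cw_series x (cw_lim x)"
  unfolding cw_series_def using infinite_cf_series_sums[of a x] by blast

text \<open>Both kinds of expansion evaluate to the same function \<open>cw_lim\<close>, so the two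
  expansions of a positive rational cannot give different values.\<close>

lemma cw_series_imp:
  assumes "cw_series x y"
  shows "y = cw_lim x"
  using assms unfolding cw_series_def
proof (elim disjE exE conjE)
  fix as
  assume "finite_cf_expansion as x"
    and "y = 1 + (\<Sum>k<length as. (-1) ^ Suc k * 2 powi - int (\<Sum>i\<le>k. as ! i))"
  then show ?thesis using finite_cf_series_value by metis
next
  fix a
  assume "infinite_cf_expansion a x"
    and "(\<lambda>k. (-1) ^ Suc k * 2 powi - int (\<Sum>i\<le>k. a i)) sums (y - 1)"
  then have "y - 1 = cw_lim x - 1" using infinite_cf_series_sums sums_unique2 by blast
  then show ?thesis by simp
qed

section \<open>Existence of expansions through complete quotients\<close>

fun cf_tail :: "nat list \<Rightarrow> real \<Rightarrow> real" where
  "cf_tail [] u = u"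
| "cf_tail (a # as) u = real a + 1 / cf_tail as u"

lemma cf_tail_nat: "cf_tail as (real a) = cf_value (as @ [a])"
  by (induction as rule: cf_value.induct) auto

lemma cf_tail_snoc: "cf_tail (as @ [a]) u = cf_tail as (real a + 1 / u)"
  by (induction as) auto

lemma cf_tail_ge_1:
  assumes "\<forall>a\<in>set as. 1 \<le> a" "u \<ge> 1"
  shows "cf_tail as u \<ge> 1"
  using assms
proof (induction as)
  case (Cons a as)
  then have "1 / cf_tail as u \<ge> 0" "real a \<ge> 1" by auto
  then have "1 \<le> real a + 1 / cf_tail as u" by linarith
  then show ?case by simp
qed simp

text \<open>Two digits at a time, since \<open>w \<mapsto> 1 / (a + w)\<close> alone need not be a strict contraction.\<close>

lemma cf_tail_contraction:
  assumes "\<forall>a\<in>set as. 1 \<le> a" "u \<ge> 1" "v \<ge> 1"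
  shows "\<bar>1 / cf_tail as u - 1 / cf_tail as v\<bar> \<le> 2 * (1 / 2) ^ length as"
  using assms(1)
proof (induction as rule: induct_list012)
  case 1
  have "\<bar>1 / u - 1 / v\<bar> \<le> 1" using assms by (intro abs_diff_unit_interval) auto
  then show ?case by simp
next
  case (2 a)
  have "1 \<le> cf_tail [a] u" "1 \<le> cf_tail [a] v"
    using cf_tail_ge_1[of "[a]"] 2 assms by auto
  then have "\<bar>1 / cf_tail [a] u - 1 / cf_tail [a] v\<bar> \<le> 1"
    by (intro abs_diff_unit_interval) auto
  then show ?case by simp
next
  case (3 a b as)
  define s t where "s = 1 / cf_tail as u" "t = 1 / cf_tail as v"
  have "cf_tail as u \<ge> 1" "cf_tail as v \<ge> 1" using 3(3) assms by (auto intro!: cf_tail_ge_1)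
  then have st: "s > 0" "t > 0" by (auto simp: s_t_def)
  have ab: "real a \<ge> 1" "real b \<ge> 1" using 3(3) by auto
  \<comment> \<open>\<open>D w\<close> is the denominator of the two-digit map, whose determinant is
    1. Two images thus differ by \<open>s - t\<close> over a product of denominators that is at
    least 4, matching two more factors 1/2. The 2 in front of the bound pays for the one-digit base
    case.\<close>
  define D where "D w = real a * (real b + w) + 1" for w
  have D: "D w \<ge> 2" if "w > 0" for w
    using mult_mono[of 1 "real a" 1 "real b + w"] ab that by (simp add: D_def)
  have inv: "1 / (real a + 1 / (real b + w)) = (real b + w) / D w" if "w > 0" for w
    using ab that by (simp add: D_def field_simps)
  have "(real b + s) / D s - (real b + t) / D t = (s - t) / (D s * D t)"
    using D[of s] D[of t] st by (simp add: field_simps) (simp add: D_def algebra_simps)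
  then have "\<bar>(real b + s) / D s - (real b + t) / D t\<bar> = \<bar>s - t\<bar> / (D s * D t)"
    using D[of s] D[of t] st by (simp add: abs_mult)
  also have "\<dots> \<le> \<bar>s - t\<bar> / 4"
    using mult_mono[of 2 "D s" 2 "D t"] D[of s] D[of t] st by (intro divide_left_mono) auto
  also have "\<bar>s - t\<bar> \<le> 2 * (1 / 2) ^ length as"
    unfolding s_t_def using 3 by auto
  finally show ?case using inv st by (simp add: s_t_def)
qed

lemma cw_series_cw_lim:
  assumes "x \<ge> 0"
  shows "cw_series x (cw_lim x)"
proof -
  \<comment> \<open>\<open>t n\<close> is the \<open>n\<close>-th complete quotient and
    \<open>a n\<close> its digit. Once a fractional part vanishes, division by zero makes all later
    \<open>t\<close> equal to 0, hence the guards on all \<open>m < n\<close> below.\<close>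
  define t where "t n = ((\<lambda>u. 1 / frac u) ^^ n) x" for n
  define a where "a n = nat \<lfloor>t n\<rfloor>" for n
  have t_Suc: "t (Suc n) = 1 / frac (t n)" for n by (simp add: t_def)
  have t_ge_1: "t (Suc n) \<ge> 1" if "frac (t n) \<noteq> 0" for n
    using frac_lt_1[of "t n"] frac_ge_0[of "t n"] that by (simp add: t_Suc le_divide_eq)
  have step: "t n = real (a n) + frac (t n)" if "t n \<ge> 0" for n
    using that by (simp add: a_def frac_def)
  have t_nonneg: "t n \<ge> 0" if "\<forall>m<n. frac (t m) \<noteq> 0" for n
    using that assms t_ge_1[of "n - 1"] by (cases n) (auto simp: t_def)
  have a_ge_1: "a n \<ge> 1" if "\<forall>m<n. frac (t m) \<noteq> 0" "n \<ge> 1" for n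
    using t_ge_1[of "n - 1"] that by (cases n) (auto simp: a_def le_nat_iff le_floor_iff)
  have x_eq: "x = cf_tail (map a [0..<n]) (t n)" if "\<forall>m<n. frac (t m) \<noteq> 0" for n
    using that
  proof (induction n)
    case (Suc n)
    then show ?case using step[of n] t_nonneg[of n] by (simp add: cf_tail_snoc t_Suc)
  qed (simp add: t_def)
  show ?thesis
  proof (cases "\<exists>n. frac (t n) = 0")
    case True
    define n where "n = (LEAST n. frac (t n) = 0)"
    have "frac (t n) = 0" unfolding n_def using True by (rule LeastI_ex)
    moreover have least: "\<forall>m<n. frac (t m) \<noteq> 0" unfolding n_def using not_less_Least by blast
    ultimately have "t n = real (a n)" using step[OF t_nonneg[OF least]] by linarith
    then have "x = cf_value (map a [0..<Suc n])"
      using x_eq[OF least] by (simp add: cf_tail_nat)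
    moreover have "1 \<le> map a [0..<Suc n] ! i" if "1 \<le> i" "i < Suc n" for i
      using a_ge_1[of i] least that by (simp del: upt_Suc)
    ultimately have "finite_cf_expansion (map a [0..<Suc n]) x"
      by (simp add: finite_cf_expansion_def del: upt_Suc)
    then show ?thesis by (rule cw_series_finiteI)
  next
    case False
    have close: "\<bar>cf_value (map a [0..<Suc (Suc n)]) - x\<bar> \<le> 2 * (1 / 2) ^ n" for n
    proof -
      \<comment> \<open>The digit \<open>a 0\<close> may be 0, while the contraction estimate needs
        positive digits. It enters only as a summand and is split off.\<close>
      define as where "as = map (a \<circ> Suc) [0..<n]"
      have as: "map a [0..<Suc n] = a 0 # as"
        unfolding as_def by (simp add: upt_conv_Cons map_Suc_upt[symmetric] del: upt_Suc)
      have "cf_value (map a [0..<Suc (Suc n)]) = cf_tail (map a [0..<Suc n]) (real (a (Suc n)))"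
        by (simp add: cf_tail_nat)
      also have "\<dots> = real (a 0) + 1 / cf_tail as (real (a (Suc n)))" unfolding as by simp
      finally have "\<bar>cf_value (map a [0..<Suc (Suc n)]) - x\<bar> =
          \<bar>1 / cf_tail as (real (a (Suc n))) - 1 / cf_tail as (t (Suc n))\<bar>"
        using x_eq[of "Suc n"] False unfolding as by simp
      also have "\<dots> \<le> 2 * (1 / 2) ^ length as"
        using a_ge_1 t_ge_1 False by (intro cf_tail_contraction) (auto simp: as_def)
      finally show ?thesis by (simp add: as_def)
    qed
    have null: "(\<lambda>n. 2 * (1 / 2 :: real) ^ n) \<longlonglongrightarrow> 0"
      by (intro tendsto_mult_right_zero LIMSEQ_power_zero) simp
    have "(\<lambda>n. cf_value (map a [0..<Suc (Suc n)]) - x) \<longlonglongrightarrow> 0"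
      by (rule Lim_null_comparison[OF always_eventually[OF allI] null])
        (use close in \<open>simp only: real_norm_def\<close>)
    then have "(\<lambda>n. cf_value (map a [0..<Suc (Suc n)])) \<longlonglongrightarrow> x"
      by (rule LIM_zero_cancel)
    then have "(\<lambda>n. cf_value (map a [0..<Suc n])) \<longlonglongrightarrow> x"
      by (rule LIMSEQ_imp_Suc[of "\<lambda>n. cf_value (map a [0..<Suc n])"])
    then have "infinite_cf_expansion a x"
      unfolding infinite_cf_expansion_def using a_ge_1 False by blast
    then show ?thesis by (rule cw_series_infiniteI)
  qed
qed

lemma cw_series_unique: "x \<ge> 0 \<Longrightarrow> \<exists>!y. cw_series x y"
  using cw_series_cw_lim cw_series_imp by blast

lemma cw_dist_eq: "x \<ge> 0 \<Longrightarrow> cw_dist x = cw_lim x"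
  unfolding cw_dist_def using cw_series_cw_lim cw_series_imp by (intro the_equality)

section \<open>Singularity\<close>

text \<open>
  On \<open>B\<close>, a disjoint Vitali subfamily of balls with large quotients has total length at most
  \<open>\<mu> B / c\<close>, where \<open>\<mu>\<close> is the Stieltjes measure of \<open>F\<close>.
\<close>

lemma negligible_large_quotients:
  fixes F :: "real \<Rightarrow> real"
  assumes F: "mono F" "continuous_on UNIV F"
    and K: "K \<in> sets borel"
    and sing: "\<And>e. e > 0 \<Longrightarrow> \<exists>B. open B \<and> emeasure lborel (K - B) \<le> ennreal e \<and>
        emeasure (interval_measure F) B \<le> ennreal e"
    and "c > 0"
  shows "negligible {x \<in> K. \<forall>d>0. \<exists>r>0. r < d \<and> F (x + r) - F (x - r) > c * r}"
    (is "negligible ?E")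
  unfolding negligible_outer_le
proof (intro allI impI)
  fix e :: real assume "e > 0"
  \<comment> \<open>Half of \<open>e\<close> is kept for \<open>K - B\<close>. The constant 20 is 2
    for the other half, times 5 for the Vitali enlargement, times 2 for passing from radius to
    length.\<close>
  define e' where "e' = min (e / 2) (e * c / 20)"
  have e': "e' > 0" "e' \<le> e / 2" "10 * (e' / c) \<le> e / 2"
    using \<open>e > 0\<close> \<open>c > 0\<close> by (auto simp: e'_def min_def field_simps)
  obtain B where B: "open B" "emeasure lborel (K - B) \<le> ennreal e'"
      "emeasure (interval_measure F) B \<le> ennreal e'"
    using sing[OF e'(1)] by blast
  \<comment> \<open>Staying inside \<open>B\<close> lets the measure of \<open>B\<close> control
    disjoint balls; the cap 1 provides the bounded radii that the covering lemma needs.\<close>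
  define I where "I = {(x, r). 0 < r \<and> r \<le> 1 \<and> cball x r \<subseteq> B \<and> F (x + r) - F (x - r) > c * r}"
  have cover: "?E \<inter> B \<subseteq> (\<Union>i\<in>I. cball (fst i) (snd i))"
  proof
    fix x assume x: "x \<in> ?E \<inter> B"
    then obtain d where d: "d > 0" "cball x d \<subseteq> B" using B(1) open_contains_cball by blast
    then have "min d 1 > 0" by simp
    with x obtain r where r: "r > 0" "r < min d 1" "F (x + r) - F (x - r) > c * r" by blast
    then have "cball x r \<subseteq> B" using d(2) by (intro order_trans[OF subset_cball d(2)]) auto
    then have "(x, r) \<in> I" using r by (simp add: I_def)
    then show "x \<in> (\<Union>i\<in>I. cball (fst i) (snd i))"
      using r(1) by (intro UN_I[of "(x, r)"]) auto
  qed
  have radius: "0 < snd i \<and> snd i \<le> 1" if "i \<in> I" for i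
    using that by (auto simp: I_def)
  have in_B: "cball (fst i) (snd i) \<subseteq> B"
    and quotient: "c * snd i < F (fst i + snd i) - F (fst i - snd i)" if "i \<in> I" for i
    using that unfolding I_def by (simp_all only: mem_Collect_eq case_prod_beta)
  obtain C where C: "countable C" "C \<subseteq> I"
      "pairwise (\<lambda>i j. disjnt (cball (fst i) (snd i)) (cball (fst j) (snd j))) C"
      "?E \<inter> B \<subseteq> (\<Union>i\<in>C. cball (fst i) (5 * snd i))"
    by (rule Vitali_covering_lemma_cballs[OF cover radius]) (blast intro: that)+
  let ?U = "\<Union>i\<in>C. cball (fst i) (5 * snd i)"
  have bound: "measure lebesgue (\<Union>i\<in>J. cball (fst i) (5 * snd i)) \<le> e / 2"
    if J: "J \<subseteq> C" "finite J" for J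
  proof -
    have "ennreal (\<Sum>i\<in>J. c * snd i) \<le> ennreal (\<Sum>i\<in>J. F (fst i + snd i) - F (fst i - snd i))"
      using J C(2) quotient by (intro ennreal_leI sum_mono) (blast intro: less_imp_le)
    also have "\<dots> = (\<Sum>i\<in>J. ennreal (F (fst i + snd i) - F (fst i - snd i)))"
      using J C(2) by (intro sum_ennreal[symmetric]) (auto simp: I_def intro!: monoD[OF F(1)])
    also have "\<dots> = (\<Sum>i\<in>J. emeasure (interval_measure F) (cball (fst i) (snd i)))"
    proof (intro sum.cong refl)
      fix i assume "i \<in> J"
      then have "snd i > 0" using J C(2) by (auto simp: I_def)
      then show "ennreal (F (fst i + snd i) - F (fst i - snd i)) =
          emeasure (interval_measure F) (cball (fst i) (snd i))"
        unfolding cball_eq_atLeastAtMost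
        by (subst emeasure_interval_measure_Icc) (auto intro: monoD[OF F(1)] F(2))
    qed
    also have "\<dots> = emeasure (interval_measure F) (\<Union>i\<in>J. cball (fst i) (snd i))"
    proof (rule sum_emeasure)
      show "disjoint_family_on (\<lambda>i. cball (fst i) (snd i)) J"
        using C(3) J(1) unfolding disjoint_family_on_def pairwise_def disjnt_def by blast
    qed (use J in auto)
    also have "\<dots> \<le> emeasure (interval_measure F) B"
    proof (rule emeasure_mono)
      have "cball (fst i) (snd i) \<subseteq> B" if "i \<in> J" for i
        using that J(1) C(2) in_B by blast
      then show "(\<Union>i\<in>J. cball (fst i) (snd i)) \<subseteq> B" by blast
    qed (use B(1) in auto)
    also have "\<dots> \<le> ennreal e'" by (rule B(3))
    finally have "(\<Sum>i\<in>J. c * snd i) \<le> e'" using e' by (simp add: ennreal_le_iff)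
    then have "(\<Sum>i\<in>J. snd i) \<le> e' / c"
      using \<open>c > 0\<close> by (simp add: field_simps flip: sum_distrib_left)
    have "measure lebesgue (\<Union>i\<in>J. cball (fst i) (5 * snd i)) \<le>
        (\<Sum>i\<in>J. measure lebesgue (cball (fst i) (5 * snd i)))"
      using J by (intro measure_UNION_le) auto
    also have "\<dots> = (\<Sum>i\<in>J. 10 * snd i)"
      using J C(2) by (intro sum.cong) (auto simp: cball_eq_atLeastAtMost I_def)
    also have "\<dots> = 10 * (\<Sum>i\<in>J. snd i)" by (simp add: sum_distrib_left)
    also have "\<dots> \<le> e / 2" using \<open>_ \<le> e' / c\<close> e'(3) by linarith
    finally show ?thesis .
  qed
  have "?U \<in> lmeasurable" "measure lebesgue ?U \<le> e / 2"
    by (intro fmeasurable_UN_bound[OF C(1) _ bound] measure_UN_bound[OF C(1) _ bound]; simp)+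
  moreover have "emeasure lebesgue (K - B) \<le> ennreal (e / 2)"
  proof -
    have "K - B \<in> sets lborel" using K B(1) by auto
    then have "emeasure lebesgue (K - B) = emeasure lborel (K - B)" by simp
    then show ?thesis using B(2) ennreal_leI[OF e'(2)] by simp
  qed
  then have "K - B \<in> lmeasurable" "measure lebesgue (K - B) \<le> e / 2"
    unfolding measure_def using K B(1) \<open>e > 0\<close>
    by (intro fmeasurableI le_less_trans[OF _ ennreal_less_top] enn2real_leI; simp)+
  ultimately have "?U \<union> (K - B) \<in> lmeasurable" "measure lebesgue (?U \<union> (K - B)) \<le> e"
    using measure_Un_le[of ?U lebesgue "K - B"] by auto
  moreover have "?E \<subseteq> ?U \<union> (K - B)" using C(4) by blast
  ultimately show "\<exists>T. ?E \<subseteq> T \<and> T \<in> lmeasurable \<and> measure lebesgue T \<le> e" by blast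
qed

text \<open>For monotone \<open>F\<close>, one-sided difference quotients are bounded by symmetric ones.\<close>

lemma derivative_zeroI:
  fixes F :: "real \<Rightarrow> real"
  assumes "mono F"
    and "\<And>k. \<not> (\<forall>d>0. \<exists>r>0. r < d \<and> F (x + r) - F (x - r) > inverse (real (Suc k)) * r)"
  shows "(F has_real_derivative 0) (at x)"
  unfolding has_field_derivative_iff
proof (rule LIM_I)
  fix e :: real assume "e > 0"
  then obtain k where k: "inverse (real (Suc k)) < e" using reals_Archimedean by blast
  obtain d where d: "d > 0" "\<And>r. 0 < r \<Longrightarrow> r < d \<Longrightarrow> F (x + r) - F (x - r) \<le> inverse (real (Suc k)) * r"
    using assms(2)[of k] by (metis not_less)
  have "norm ((F y - F x) / (y - x) - 0) < e" if "y \<noteq> x" "norm (y - x) < d" for y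
  proof -
    define r where "r = \<bar>y - x\<bar>"
    have "r > 0" "r < d" using that by (auto simp: r_def)
    have "x - r \<le> x" "x \<le> x + r" "x - r \<le> y" "y \<le> x + r" by (auto simp: r_def)
    then have "F (x - r) \<le> F x" "F x \<le> F (x + r)" "F (x - r) \<le> F y" "F y \<le> F (x + r)"
      using monoD[OF assms(1)] by blast+
    then have "\<bar>F y - F x\<bar> \<le> F (x + r) - F (x - r)" by linarith
    also have "\<dots> \<le> inverse (real (Suc k)) * r" by (rule d(2)) fact+
    also have "\<dots> < e * r" using k \<open>r > 0\<close> by (rule mult_strict_right_mono)
    finally have "\<bar>F y - F x\<bar> / r < e" using \<open>r > 0\<close> by (simp only: pos_divide_less_eq)
    then show ?thesis by (simp add: r_def abs_divide)
  qed
  then show "\<exists>d>0. \<forall>y. y \<noteq> x \<and> norm (y - x) < d \<longrightarrow> norm ((F y - F x) / (y - x) - 0) < e"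
    using d(1) by blast
qed

text \<open>Where the derivative is not 0, symmetric quotients exceed some
  \<open>1 / (k + 1)\<close> at arbitrarily small radii, so the exceptional points lie in countably
  many negligible sets.\<close>

lemma singular_imp_derivative_zero_AE:
  fixes F :: "real \<Rightarrow> real"
  assumes F: "mono F" "continuous_on UNIV F"
    and K: "K \<in> sets borel"
    and sing: "\<And>e. e > 0 \<Longrightarrow> \<exists>B. open B \<and> emeasure lborel (K - B) \<le> ennreal e \<and>
        emeasure (interval_measure F) B \<le> ennreal e"
  shows "AE x\<in>K in lebesgue. (F has_real_derivative 0) (at x)"
proof -
  define E where "E k = {x \<in> K. \<forall>d>0. \<exists>r>0. r < d \<and>
      F (x + r) - F (x - r) > inverse (real (Suc k)) * r}" for k
  have "negligible (E k)" for k
    unfolding E_def by (intro negligible_large_quotients assms) auto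
  then have "AE x in lebesgue. x \<notin> E k" for k
    by (simp add: negligible_iff_null_sets AE_not_in)
  then have "AE x in lebesgue. \<forall>k. x \<notin> E k" by (simp add: AE_all_countable)
  then show ?thesis
  proof (rule AE_mp, intro AE_I2 impI)
    fix x assume "\<forall>k. x \<notin> E k" "x \<in> K"
    then show "(F has_real_derivative 0) (at x)"
      by (intro derivative_zeroI F) (auto simp: E_def)
  qed
qed

section \<open>Geometric decay of the cell sums\<close>

text \<open>
  The sum of \<open>sqrt (\<mu> J * |J|)\<close> over the Stern--Brocot intervals \<open>J\<close> that lie \<open>n\<close> levels below an
  interval with endpoint denominators \<open>d\<close> and \<open>c\<close>, hence of length \<open>1 / (c * d)\<close>, if that
  interval has measure \<open>1\<close> and each split halves the measure.
\<close>

fun cell_sum :: "nat \<Rightarrow> real \<Rightarrow> real \<Rightarrow> real" where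
  "cell_sum 0 c d = 1 / sqrt (c * d)"
| "cell_sum (Suc n) c d = (cell_sum n (c + d) d + cell_sum n c (c + d)) / sqrt 2"

lemma cell_sum_nonneg: "c > 0 \<Longrightarrow> d > 0 \<Longrightarrow> cell_sum n c d \<ge> 0"
  by (induction n arbitrary: c d) auto

text \<open>Relative to the square of \<open>cell_sum 0 c d\<close> the factor is at most 1, with
  equality only for \<open>c = d\<close>, when the mediant bisects the interval. The term
  \<open>sqrt (c * d) / (c + d)\<close> measures the balance of the split.\<close>

lemma cell_sum_1_sq:
  assumes "c > 0" "d > 0"
  shows "(cell_sum 1 c d)\<^sup>2 = (1 / 2 + sqrt (c * d) / (c + d)) / (c * d)"
proof -
  define s where "s = sqrt (c * d)"
  have s: "s > 0" "s * s = c * d" using assms by (auto simp: s_def)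
  have "sqrt ((c + d) * d) * sqrt (c * (c + d)) = s * (c + d)"
  proof -
    have "sqrt ((c + d) * d) * sqrt (c * (c + d)) = sqrt (c * d * (c + d)\<^sup>2)"
      unfolding real_sqrt_mult[symmetric] by (simp only: power2_eq_square mult_ac)
    also have "\<dots> = s * (c + d)" using assms by (simp add: real_sqrt_mult s_def)
    finally show ?thesis .
  qed
  then have cross: "1 / sqrt ((c + d) * d) * (1 / sqrt (c * (c + d))) = 1 / (s * (c + d))"
    by simp
  have sq: "(1 / sqrt ((c + d) * d))\<^sup>2 = 1 / ((c + d) * d)" "(1 / sqrt (c * (c + d)))\<^sup>2 = 1 / (c * (c + d))"
    using assms by (auto simp: power_divide)
  have "(cell_sum 1 c d)\<^sup>2 =
      ((1 / sqrt ((c + d) * d))\<^sup>2 + (1 / sqrt (c * (c + d)))\<^sup>2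
        + 2 * (1 / sqrt ((c + d) * d) * (1 / sqrt (c * (c + d))))) / 2"
    by (simp add: power_divide power2_sum)
  also have "\<dots> = (1 / ((c + d) * d) + 1 / (c * (c + d)) + 2 * (1 / (s * (c + d)))) / 2"
    unfolding cross sq by simp
  also have "1 / ((c + d) * d) + 1 / (c * (c + d)) = 1 / (c * d)"
    using assms by (simp add: divide_simps; simp add: algebra_simps)
  also have "1 / (s * (c + d)) = s / (c + d) / (c * d)"
    using s(1) assms unfolding s(2)[symmetric] by (simp add: divide_simps)
  finally show ?thesis using assms by (simp add: s_def add_divide_distrib)
qed

lemma sqrt_ratio_le_half:
  assumes "c > 0" "d > 0"
  shows "sqrt (c * d) / (c + d) \<le> 1 / 2"
  using arith_geo_mean_sqrt[of c d] assms by (simp add: field_simps)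

text \<open>This is the balance term of the child \<open>(c, c + d)\<close>. Its largest value is
  \<open>sqrt 2 / 3 < 0.472\<close>, at \<open>c = d\<close>; 12/25 is a convenient rational bound
  below 1/2.\<close>

lemma sqrt_ratio_le:
  assumes "0 < c" "c \<le> d"
  shows "sqrt (c * (c + d)) / (2 * c + d) \<le> 12 / 25"
proof -
  have "c * c \<le> d * d" "c * d \<le> d * d" using assms by (auto intro!: mult_mono)
  moreover have "0 \<le> d * d" by simp
  \<comment> \<open>With \<open>u\<close>, \<open>v\<close>, \<open>w\<close> for
    \<open>c * c\<close>, \<open>c * d\<close>, \<open>d * d\<close>, this amounts to
    \<open>49 * (u + v) <= 144 * w\<close>, which follows from
    \<open>u + v <= 2 * w\<close>.\<close>
  moreover have "u + v \<le> (576 * u + 576 * v + 144 * w) / 625" if "u \<le> w" "v \<le> w" "0 \<le> w"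
    for u v w :: real
    using that by (simp add: field_simps)
  ultimately have "c * c + c * d \<le> (576 * (c * c) + 576 * (c * d) + 144 * (d * d)) / 625"
    by blast
  also have "\<dots> = (12 / 25 * (2 * c + d))\<^sup>2"
    by (simp add: power2_eq_square field_simps)
  finally have "c * (c + d) \<le> (12 / 25 * (2 * c + d))\<^sup>2"
    by (simp only: distrib_left)
  then have "sqrt (c * (c + d)) \<le> 12 / 25 * (2 * c + d)"
    using assms by (intro real_le_lsqrt) auto
  then show ?thesis using assms by (simp add: pos_divide_le_eq)
qed

text \<open>A split into equal halves cannot happen twice in a row, which gives a factor below \<open>1\<close>.\<close>

lemma cell_sum_2:
  assumes "c > 0" "d > 0"
  shows "cell_sum 2 c d \<le> sqrt (99 / 100) * cell_sum 0 c d"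
proof -
  define A B where "A = cell_sum 1 (c + d) d" and "B = cell_sum 1 c (c + d)"
  define f g where "f = sqrt ((c + d) * d) / (c + d + d)" and "g = sqrt (c * (c + d)) / (c + (c + d))"
  have A: "A\<^sup>2 = (1 / 2 + f) / ((c + d) * d)"
    unfolding A_def f_def by (rule cell_sum_1_sq) (use assms in auto)
  have B: "B\<^sup>2 = (1 / 2 + g) / (c * (c + d))"
    unfolding B_def g_def by (rule cell_sum_1_sq) (use assms in auto)
  have "f \<le> 1 / 2" "g \<le> 1 / 2"
    unfolding f_def g_def using assms by (intro sqrt_ratio_le_half; simp)+
  \<comment> \<open>The child that keeps the smaller of \<open>c\<close> and \<open>d\<close> is
    split unevenly.\<close>
  moreover have "f \<le> 12 / 25 \<or> g \<le> 12 / 25"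
    using sqrt_ratio_le[of c d] sqrt_ratio_le[of d c] assms
    by (cases "c \<le> d") (auto simp: f_def g_def algebra_simps)
  ultimately have fg: "f + g \<le> 49 / 50" by linarith
  \<comment> \<open>Cauchy--Schwarz with the relative lengths \<open>c / (c + d)\<close> and
    \<open>d / (c + d)\<close> of the two children as weights; this square is its defect.\<close>
  have "0 \<le> (d * A - c * B)\<^sup>2 / (c * d)" using assms by simp
  also have "\<dots> = (c + d) / c * A\<^sup>2 + (c + d) / d * B\<^sup>2 - (A + B)\<^sup>2"
    using assms by (simp add: power2_eq_square field_simps)
  also have "(c + d) / c * A\<^sup>2 + (c + d) / d * B\<^sup>2 = (1 + (f + g)) / (c * d)"
    unfolding A B using assms by (simp add: divide_simps)
  finally have "(A + B)\<^sup>2 \<le> (1 + (f + g)) / (c * d)" by simp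
  also have "\<dots> \<le> (99 / 50) / (c * d)"
    using fg assms by (intro divide_right_mono) auto
  finally have "((A + B) / sqrt 2)\<^sup>2 \<le> (99 / 100) / (c * d)"
    by (simp add: power_divide)
  then have "(A + B) / sqrt 2 \<le> sqrt ((99 / 100) / (c * d))" by (rule real_le_rsqrt)
  also have "\<dots> = sqrt (99 / 100) * cell_sum 0 c d"
    by (simp only: real_sqrt_divide[of "99 / 100" "c * d"] cell_sum.simps times_divide_eq_right mult_1_right)
  also have "(A + B) / sqrt 2 = cell_sum 2 c d"
    by (simp add: numeral_2_eq_2 A_def B_def)
  finally show ?thesis .
qed

text \<open>Two levels are peeled off at the top: the induction hypothesis treats the four
  grandchildren, and \<open>cell_sum_2\<close> the sum that remains.\<close>

lemma cell_sum_even: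
  assumes "c > 0" "d > 0"
  shows "cell_sum (2 * n) c d \<le> sqrt (99 / 100) ^ n / sqrt (c * d)"
  using assms
proof (induction n arbitrary: c d)
  case (Suc n)
  define q where "q = sqrt (99 / 100 :: real)"
  have "cell_sum (2 * Suc n) c d =
     (cell_sum (2 * n) (c + d + d) d + cell_sum (2 * n) (c + d) (c + d + d) +
      (cell_sum (2 * n) (c + (c + d)) (c + d) + cell_sum (2 * n) c (c + (c + d)))) / sqrt 2 / sqrt 2"
    by (simp add: add_divide_distrib)
  also have "\<dots> \<le> (q ^ n * (1 / sqrt ((c + d + d) * d)) + q ^ n * (1 / sqrt ((c + d) * (c + d + d))) +
     (q ^ n * (1 / sqrt ((c + (c + d)) * (c + d))) + q ^ n * (1 / sqrt (c * (c + (c + d)))))) / sqrt 2 / sqrt 2"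
    using Suc.IH[of "c + d + d" d] Suc.IH[of "c + d" "c + d + d"]
      Suc.IH[of "c + (c + d)" "c + d"] Suc.IH[of c "c + (c + d)"] Suc.prems
    by (intro divide_right_mono add_mono) (auto simp: q_def)
  also have "\<dots> = q ^ n * cell_sum 2 c d"
    by (simp add: numeral_2_eq_2 add_divide_distrib distrib_left)
  also have "\<dots> \<le> q ^ n * (q * cell_sum 0 c d)"
    using cell_sum_2[OF Suc.prems] by (intro mult_left_mono) (auto simp: q_def)
  finally show ?case by (simp add: q_def mult_ac)
qed simp

section \<open>Self-similarity on Stern--Brocot intervals and conclusion\<close>

text \<open>
  Here \<open>(a x + b) / (c x + d)\<close> maps \<open>[0, \<infinity>]\<close> to the interval with endpoints \<open>b / d\<close> and \<open>a / c\<close>,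
  and \<open>F\<close> is reproduced on it with scale \<open>s\<close>.
\<close>

lemma cell_splitting:
  fixes a b c d s t :: real
  assumes "a \<ge> 0" "b \<ge> 0" "c > 0" "d > 0" "a * d - b * c = 1" "s > 0"
    and "\<And>x. x \<ge> 0 \<Longrightarrow> cw_lim ((a * x + b) / (c * x + d)) = s * cw_lim x + t"
    and "cw_lim (a / c) = s + t"
  shows "\<exists>B. open B \<and>
    emeasure lborel ({b / d..a / c} - B) \<le> ennreal (sqrt s * cell_sum n c d) \<and>
    emeasure (interval_measure cw_lim) B \<le> ennreal (sqrt s * cell_sum n c d)"
  using assms
proof (induction n arbitrary: a b c d s t)
  case (0 a b c d s t)
  have len: "a / c - b / d = 1 / (c * d)" using 0 by (simp add: field_simps)
  then have "b / d \<le> a / c" using 0(3,4) by (smt (verit) divide_pos_pos mult_pos_pos)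
  have prod: "sqrt s * cell_sum 0 c d = sqrt (s * (1 / (c * d)))"
    by (simp add: real_sqrt_mult real_sqrt_divide)
  have pos: "1 / (c * d) > 0" using 0 by simp
  \<comment> \<open>The open cell is put into \<open>B\<close> or left out, whichever costs less:
    the smaller of the measure \<open>s\<close> and the length \<open>1 / (c * d)\<close> is at most
    their geometric mean.\<close>
  show ?case
  proof (cases "s \<le> 1 / (c * d)")
    case True
    have "cw_lim (b / d) = t" using 0(7)[of 0] by (simp add: cw_lim_nonpos)
    have "emeasure (interval_measure cw_lim) {b / d<..<a / c} \<le>
        emeasure (interval_measure cw_lim) {b / d..a / c}"
      by (intro emeasure_mono) auto
    also have "\<dots> = ennreal (cw_lim (a / c) - cw_lim (b / d))"
      using \<open>b / d \<le> a / c\<close>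
      by (intro emeasure_interval_measure_Icc) (auto intro: monoD[OF cw_lim_mono] cw_lim_continuous)
    also have "\<dots> = ennreal s" using 0(8) \<open>cw_lim (b / d) = t\<close> by simp
    also have "\<dots> \<le> ennreal (sqrt (s * (1 / (c * d))))"
      using True 0(6) by (intro ennreal_leI real_le_rsqrt) (use mult_left_mono[of s "1 / (c * d)" s] in \<open>simp add: power2_eq_square\<close>)
    finally have "emeasure (interval_measure cw_lim) {b / d<..<a / c} \<le>
        ennreal (sqrt s * cell_sum 0 c d)" unfolding prod .
    moreover have "{b / d..a / c} - {b / d<..<a / c} = {b / d, a / c}"
      using \<open>b / d \<le> a / c\<close> by auto
    then have "emeasure lborel ({b / d..a / c} - {b / d<..<a / c}) = 0"
      by (simp only:) (intro emeasure_lborel_countable, simp)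
    ultimately show ?thesis by (intro exI[of _ "{b / d<..<a / c}"]) auto
  next
    case False
    have "emeasure lborel {b / d..a / c} = ennreal (1 / (c * d))"
      using \<open>b / d \<le> a / c\<close> len by simp
    also have "\<dots> \<le> ennreal (sqrt (s * (1 / (c * d))))"
      using False pos
      by (intro ennreal_leI real_le_rsqrt) (simp add: power2_eq_square mult_right_mono del: times_divide_eq_right times_divide_eq_left)
    finally show ?thesis unfolding prod by (intro exI[of _ "{}"]) auto
  qed
next
  case (Suc n a b c d s t)
  let ?mid = "(a + b) / (c + d)" and ?\<mu> = "interval_measure cw_lim"
  have mid: "cw_lim ?mid = s / 2 + t"
    using Suc.prems(7)[of 1] cw_lim_add_one[of 0] by (simp add: cw_lim_nonpos)
  \<comment> \<open>Precomposing with the child maps \<open>x / (x + 1)\<close> and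
    \<open>x + 1\<close> turns the cell map into those of the two parts cut at the mediant; the
    functional equations halve the scale.\<close>
  have left: "cw_lim (((a + b) * x + b) / ((c + d) * x + d)) = s / 2 * cw_lim x + t" if "x \<ge> 0" for x
  proof -
    have "(a * (x / (x + 1)) + b) / (c * (x / (x + 1)) + d) = ((a + b) * x + b) / ((c + d) * x + d)"
    proof -
      have "a * (x / (x + 1)) + b = ((a + b) * x + b) / (x + 1)"
        "c * (x / (x + 1)) + d = ((c + d) * x + d) / (x + 1)"
        using that by (auto simp: field_simps)
      then show ?thesis using that by simp
    qed
    then show ?thesis using Suc.prems(7)[of "x / (x + 1)"] cw_lim_left[OF that] that by simp
  qed
  have right: "cw_lim ((a * x + (a + b)) / (c * x + (c + d))) = s / 2 * cw_lim x + (s / 2 + t)"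
    if "x \<ge> 0" for x
    using Suc.prems(7)[of "x + 1"] cw_lim_add_one[OF that] that by (simp add: algebra_simps)
  obtain B1 where B1: "open B1"
      "emeasure lborel ({b / d..?mid} - B1) \<le> ennreal (sqrt (s / 2) * cell_sum n (c + d) d)"
      "emeasure ?\<mu> B1 \<le> ennreal (sqrt (s / 2) * cell_sum n (c + d) d)"
    using Suc.IH[of "a + b" b "c + d" d "s / 2" t] Suc.prems left mid by (auto simp: algebra_simps)
  obtain B2 where B2: "open B2"
      "emeasure lborel ({?mid..a / c} - B2) \<le> ennreal (sqrt (s / 2) * cell_sum n c (c + d))"
      "emeasure ?\<mu> B2 \<le> ennreal (sqrt (s / 2) * cell_sum n c (c + d))"
    using Suc.IH[of a "a + b" c "c + d" "s / 2" "s / 2 + t"] Suc.prems right by (auto simp: algebra_simps)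
  \<comment> \<open>The halved scale supplies the factor \<open>1 / sqrt 2\<close> built into
    \<open>cell_sum\<close>.\<close>
  have sum: "ennreal (sqrt (s / 2) * cell_sum n (c + d) d) + ennreal (sqrt (s / 2) * cell_sum n c (c + d)) =
      ennreal (sqrt s * cell_sum (Suc n) c d)"
    using Suc.prems cell_sum_nonneg[of "c + d" d n] cell_sum_nonneg[of c "c + d" n]
    by (subst ennreal_plus[symmetric]) (auto simp: real_sqrt_divide field_simps)
  have "emeasure lborel ({b / d..a / c} - (B1 \<union> B2)) \<le>
      emeasure lborel (({b / d..?mid} - B1) \<union> ({?mid..a / c} - B2))"
    using B1(1) B2(1) by (intro emeasure_mono) auto
  also have "\<dots> \<le> emeasure lborel ({b / d..?mid} - B1) + emeasure lborel ({?mid..a / c} - B2)"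
    using B1(1) B2(1) by (intro emeasure_subadditive) auto
  also have "\<dots> \<le> ennreal (sqrt s * cell_sum (Suc n) c d)"
    unfolding sum[symmetric] using B1(2) B2(2) by (rule add_mono)
  finally have leb: "emeasure lborel ({b / d..a / c} - (B1 \<union> B2)) \<le> ennreal (sqrt s * cell_sum (Suc n) c d)" .
  have "emeasure ?\<mu> (B1 \<union> B2) \<le> emeasure ?\<mu> B1 + emeasure ?\<mu> B2"
    using B1(1) B2(1) by (intro emeasure_subadditive) auto
  also have "\<dots> \<le> ennreal (sqrt s * cell_sum (Suc n) c d)"
    unfolding sum[symmetric] using B1(3) B2(3) by (rule add_mono)
  finally show ?case using leb B1(1) B2(1) by (intro exI[of _ "B1 \<union> B2"]) auto
qed

text \<open>The whole half-line would be a cell with endpoint \<open>1 / 0\<close>; the unit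
  intervals are bounded cells with both denominators 1.\<close>

lemma cw_lim_derivative_AE_unit:
  "AE x\<in>{real m..real m + 1} in lebesgue. (cw_lim has_real_derivative 0) (at x)"
proof (rule singular_imp_derivative_zero_AE[OF cw_lim_mono cw_lim_continuous])
  fix e :: real assume "e > 0"
  define q where "q = sqrt (99 / 100 :: real)"
  have q: "0 < q" "q < 1" by (auto simp: q_def)
  then obtain n where n: "q ^ n < e" using real_arch_pow_inv[of e q] \<open>e > 0\<close> by auto
  \<comment> \<open>\<open>s\<close> is the mass of \<open>[m, m + 1]\<close>, namely
    \<open>2^(-m) - 2^(-(m + 1))\<close>, and \<open>1 - 2 * s\<close> below is the value of
    \<open>cw_lim\<close> at \<open>m\<close>.\<close>
  define s :: real where "s = (1 / 2) ^ Suc m"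
  have s: "0 < s" "s \<le> 1" unfolding s_def by (simp, intro power_le_one) auto
  have "sqrt s * cell_sum (2 * n) 1 1 \<le> 1 * (q ^ n / sqrt (1 * 1))"
    unfolding q_def using s by (intro mult_mono cell_sum_even cell_sum_nonneg) auto
  then have le: "ennreal (sqrt s * cell_sum (2 * n) 1 1) \<le> ennreal e"
    using n by (intro ennreal_leI) auto
  have "cw_lim (((real m + 1) * x + real m) / (1 * x + 1)) = s * cw_lim x + (1 - 2 * s)" if "x \<ge> 0" for x
  proof -
    have "((real m + 1) * x + real m) / (1 * x + 1) = real m + x / (x + 1)"
      using that by (simp add: field_simps)
    then show ?thesis
      using cw_lim_add_nat[of "x / (x + 1)" m] cw_lim_left[OF that] that by (simp add: s_def algebra_simps)
  qed
  moreover have "cw_lim ((real m + 1) / 1) = s + (1 - 2 * s)"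
    using cw_lim_add_nat[of 0 "Suc m"] by (simp add: s_def cw_lim_nonpos add.commute)
  ultimately have "\<exists>B. open B \<and>
    emeasure lborel ({real m / 1..(real m + 1) / 1} - B) \<le> ennreal (sqrt s * cell_sum (2 * n) 1 1) \<and>
    emeasure (interval_measure cw_lim) B \<le> ennreal (sqrt s * cell_sum (2 * n) 1 1)"
    using s by (intro cell_splitting) auto
  then show "\<exists>B. open B \<and> emeasure lborel ({real m..real m + 1} - B) \<le> ennreal e \<and>
      emeasure (interval_measure cw_lim) B \<le> ennreal e"
    using le by (auto intro: order_trans)
qed auto

lemma cw_lim_derivative_AE:
  "AE x\<in>{0..} in lebesgue. (cw_lim has_real_derivative 0) (at x)"
proof -
  have "AE x in lebesgue. \<forall>m. x \<in> {real m..real m + 1} \<longrightarrow> (cw_lim has_real_derivative 0) (at x)"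
    unfolding AE_all_countable using cw_lim_derivative_AE_unit by blast
  then show ?thesis
  proof (rule AE_mp, intro AE_I2 impI)
    fix x :: real
    assume *: "\<forall>m. x \<in> {real m..real m + 1} \<longrightarrow> (cw_lim has_real_derivative 0) (at x)" and "x \<in> {0..}"
    then have "x \<in> {real (nat \<lfloor>x\<rfloor>)..real (nat \<lfloor>x\<rfloor>) + 1}"
      using real_of_int_floor_add_one_ge[of x] by simp
    with * show "(cw_lim has_real_derivative 0) (at x)" by blast
  qed
qed

theorem theorem5:
  shows "(\<forall>x\<ge>0. \<exists>!y. cw_series x y) \<and>
     uniform_limit {0..} cw_dist_gen cw_dist sequentially \<and>
     cw_dist 0 = 0 \<and>
     (cw_dist \<longlongrightarrow> 1) at_top \<and>
     mono_on {0..} cw_dist \<and>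
     continuous_on {0..} cw_dist \<and>
     (AE x\<in>{0..} in lebesgue. (cw_dist has_real_derivative 0) (at x within {0..}))"
proof (intro conjI allI impI)
  fix x :: real assume "x \<ge> 0"
  then show "\<exists>!y. cw_series x y" by (rule cw_series_unique)
next
  have "uniform_limit {0..} cw_dist_gen cw_lim sequentially"
    using uniform_limit_cw_dist_gen by (rule uniform_limit_on_subset) simp
  moreover have "uniform_limit {0..} cw_dist_gen cw_dist sequentially \<longleftrightarrow>
      uniform_limit {0..} cw_dist_gen cw_lim sequentially"
    by (rule uniform_limit_cong) (simp_all add: cw_dist_eq)
  ultimately show "uniform_limit {0..} cw_dist_gen cw_dist sequentially" by blast
next
  show "cw_dist 0 = 0" by (simp add: cw_dist_eq cw_lim_nonpos)
next
  have "\<forall>\<^sub>F x in at_top. cw_lim x = cw_dist x"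
    using eventually_ge_at_top[of 0] by eventually_elim (simp add: cw_dist_eq)
  with cw_lim_at_top show "(cw_dist \<longlongrightarrow> 1) at_top" by (rule Lim_transform_eventually)
next
  show "mono_on {0..} cw_dist"
    using monoD[OF cw_lim_mono] by (auto intro!: mono_onI simp: cw_dist_eq)
next
  have "continuous_on {0..} cw_lim" using cw_lim_continuous by (rule continuous_on_subset) simp
  then show "continuous_on {0..} cw_dist"
    by (subst continuous_on_cong[OF refl, of _ _ cw_lim]) (auto simp: cw_dist_eq)
next
  show "AE x\<in>{0..} in lebesgue. (cw_dist has_real_derivative 0) (at x within {0..})"
    using cw_lim_derivative_AE
  proof (rule AE_mp, intro AE_I2 impI)
    fix x :: real
    assume "x \<in> {0..} \<longrightarrow> (cw_lim has_real_derivative 0) (at x)" and "x \<in> {0..}"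
    then have "(cw_lim has_real_derivative 0) (at x within {0..})"
      by (auto intro: has_field_derivative_at_within)
    then show "(cw_dist has_real_derivative 0) (at x within {0..})"
      by (rule has_field_derivative_transform_within[of _ _ _ _ 1])
        (use \<open>x \<in> {0..}\<close> in \<open>auto simp: cw_dist_eq\<close>)
  qed
qed

end
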